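(* Assume that the system $x_{k+1}=F_kx_k+G_kx_kw_k$, $y_k=H_kx_k$, $k=0,1,2,\dots$, is periodic with period $\tau>0$, i.e. $F_{k+\tau}=F_k$, $G_{k+\tau}=G_k$, $H_{k+\tau}=H_k$ for all $k\ge0$. Let $N\ge0$ be any fixed integer. If (i) the system is $\mathcal K^{N}$-exactly detectable; (ii) $\{P_k\ge0\}_{k\ge 0}$ is a positive semi-definite matrix sequence which solves the generalized Lyapunov equation $$-P_k+F_k^TP_{k+1}F_k+G_k^TP_{k+1}G_k+H_k^TH_k=0,\qquad k=0,1,2,\dots;$$ (iii) $\mathrm{Ker}(P_0)=\mathrm{Ker}(P_1)=\cdots=\mathrm{Ker}(P_{\tau-1})$, then the periodic system is ESMS.
   Context: $\{w_k\}_{k\ge 0}$ is a one-dimensional independent white noise process on a probability space, with $E w_k=0$, $E[w_kw_j]=\delta_{kj}$; $\mathcal F_k=\sigma(w_0,\dots,w_k)$ and $\mathcal F_{-1}$ is the trivial sigma-algebra; $l^2_{\mathcal F_k}$ is the set of $\mathcal F_k$-measurable random vectors $x$ with $E\|x\|^2<\infty$. $F_k,G_k\in\mathbb R^{n\times n}$, $H_k\in\mathbb R^{m\times n}$ are deterministic real matrices; $x_k\in\mathbb R^n$, $y_k\in\mathbb R^m$. $A\ge0$ means $A$ is real symmetric positive semi-definite. A state $x_{k_0}\in l^2_{\mathcal F_{k_0-1}}$ at time $k_0$ is $k_0^{s_0}$-unobservable if the output generated from it satisfies $y_k=0$ a.s. for all $k\in[k_0,k_0+s_0]$. The system is $k_0^{s_0}$-exactly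 detectable if there are constants $\beta\ge1$, $0<\lambda<1$ such that for every $k_0^{s_0}$-unobservable state $\xi$ the trajectory with $x_{k_0}=\xi$ satisfies $E\|x_k\|^2\le\beta E\|\xi\|^2\lambda^{k-k_0}$ for all $k\ge k_0$. For an integer $N\ge0$, the system is $\mathcal K^N$-exactly detectable if it is $k_0^N$-exactly detectable for every $k_0\ge 0$. ESMS (exponentially stable in mean square): there exist $\beta\ge 1$ and $\lambda\in(0,1)$ such that for any $0\le k_0\le k<+\infty$ and any state $x_{k_0}\in l^2_{\mathcal F_{k_0-1}}$ at time $k_0$, the trajectory started from $x_{k_0}$ satisfies $E\|x_k\|^2\le\beta E\|x_{k_0}\|^2\lambda^{k-k_0}$. *)

theory Defs
  imports "HOL-Probability.Probability"
begin

text \<open>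
  The probability space \<open>M\<close>, the noise \<open>w\<close> and the coefficients \<open>F\<close>, \<open>G\<close>, \<open>H\<close> of the system
  \<open>x(k+1) = F(k) x(k) + G(k) x(k) w(k)\<close>, \<open>y(k) = H(k) x(k)\<close> are explicit parameters throughout.
\<close>

text \<open>
  Square integrability is required separately because the Bochner integral of a
  non-integrable function is 0.
\<close>

definition independent_white_noise :: "'a measure \<Rightarrow> (nat \<Rightarrow> 'a \<Rightarrow> real) \<Rightarrow> bool" where
  "independent_white_noise M w \<longleftrightarrow>
     prob_space M \<and>
     prob_space.indep_vars M (\<lambda>_. borel) w UNIV \<and>
     (\<forall>k. integrable M (\<lambda>\<omega>. (w k \<omega>)\<^sup>2)) \<and>
     (\<forall>k. (\<integral>\<omega>. w k \<omega> \<partial>M) = 0) \<and>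
     (\<forall>k j. (\<integral>\<omega>. w k \<omega> * w j \<omega> \<partial>M) = (if k = j then 1 else 0))"

text \<open>
  The sigma-algebra generated by \<open>w 0, \<dots>, w (k - 1)\<close>. The index is shifted by one with respect
  to the usual natural filtration, so that index \<open>0\<close> gives the trivial sigma-algebra.
\<close>

definition noise_past :: "'a measure \<Rightarrow> (nat \<Rightarrow> 'a \<Rightarrow> real) \<Rightarrow> nat \<Rightarrow> 'a measure" where
  "noise_past M w k =
     sigma (space M) {w i -` A \<inter> space M | i A. i < k \<and> A \<in> sets borel}"

definition l2_states ::
    "'a measure \<Rightarrow> (nat \<Rightarrow> 'a \<Rightarrow> real) \<Rightarrow> nat \<Rightarrow> ('a \<Rightarrow> real ^ 'n) set" where
  "l2_states M w k =
     {\<xi> \<in> borel_measurable (noise_past M w k). integrable M (\<lambda>\<omega>. (norm (\<xi> \<omega>))\<^sup>2)}"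

text \<open>
  \<open>trajectory F G w k0 \<xi> j\<close> is the state at time \<open>k0 + j\<close> of the solution with state \<open>\<xi>\<close> at
  time \<open>k0\<close>.
\<close>

primrec trajectory ::
    "(nat \<Rightarrow> real ^ 'n ^ 'n) \<Rightarrow> (nat \<Rightarrow> real ^ 'n ^ 'n) \<Rightarrow> (nat \<Rightarrow> 'a \<Rightarrow> real) \<Rightarrow>
     nat \<Rightarrow> ('a \<Rightarrow> real ^ 'n) \<Rightarrow> nat \<Rightarrow> 'a \<Rightarrow> real ^ 'n" where
  "trajectory F G w k0 \<xi> 0 = \<xi>"
| "trajectory F G w k0 \<xi> (Suc j) =
     (\<lambda>\<omega>. F (k0 + j) *v trajectory F G w k0 \<xi> j \<omega>
        + w (k0 + j) \<omega> *\<^sub>R (G (k0 + j) *v trajectory F G w k0 \<xi> j \<omega>))"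

definition unobservable ::
    "'a measure \<Rightarrow> (nat \<Rightarrow> 'a \<Rightarrow> real) \<Rightarrow> (nat \<Rightarrow> real ^ 'n ^ 'n) \<Rightarrow> (nat \<Rightarrow> real ^ 'n ^ 'n) \<Rightarrow>
     (nat \<Rightarrow> real ^ 'n ^ 'm) \<Rightarrow> nat \<Rightarrow> nat \<Rightarrow> ('a \<Rightarrow> real ^ 'n) \<Rightarrow> bool" where
  "unobservable M w F G H k0 s0 \<xi> \<longleftrightarrow>
     \<xi> \<in> l2_states M w k0 \<and>
     (\<forall>k\<in>{k0..k0 + s0}. AE \<omega> in M. H k *v trajectory F G w k0 \<xi> (k - k0) \<omega> = 0)"

text \<open>
  If \<open>w\<close> is an independent white noise and \<open>\<xi>\<close> lies in \<open>l2_states M w k0\<close>, then the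
  trajectory starting from \<open>\<xi>\<close> is square integrable at all times, so the integrals below are
  genuine second moments.
\<close>

definition exactly_detectable_at ::
    "'a measure \<Rightarrow> (nat \<Rightarrow> 'a \<Rightarrow> real) \<Rightarrow> (nat \<Rightarrow> real ^ 'n ^ 'n) \<Rightarrow> (nat \<Rightarrow> real ^ 'n ^ 'n) \<Rightarrow>
     (nat \<Rightarrow> real ^ 'n ^ 'm) \<Rightarrow> nat \<Rightarrow> nat \<Rightarrow> bool" where
  "exactly_detectable_at M w F G H k0 s0 \<longleftrightarrow>
     (\<exists>\<beta> \<rho>::real. 1 \<le> \<beta> \<and> 0 < \<rho> \<and> \<rho> < 1 \<and>
        (\<forall>\<xi>. unobservable M w F G H k0 s0 \<xi> \<longrightarrow>
          (\<forall>k\<ge>k0. (\<integral>\<omega>. (norm (trajectory F G w k0 \<xi> (k - k0) \<omega>))\<^sup>2 \<partial>M)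
                    \<le> \<beta> * (\<integral>\<omega>. (norm (\<xi> \<omega>))\<^sup>2 \<partial>M) * \<rho> ^ (k - k0))))"

text \<open>The constants \<open>\<beta>\<close>, \<open>\<rho>\<close> may depend on the initial time \<open>k0\<close> here.\<close>

definition K_exactly_detectable ::
    "'a measure \<Rightarrow> (nat \<Rightarrow> 'a \<Rightarrow> real) \<Rightarrow> (nat \<Rightarrow> real ^ 'n ^ 'n) \<Rightarrow> (nat \<Rightarrow> real ^ 'n ^ 'n) \<Rightarrow>
     (nat \<Rightarrow> real ^ 'n ^ 'm) \<Rightarrow> nat \<Rightarrow> bool" where
  "K_exactly_detectable M w F G H N \<longleftrightarrow> (\<forall>k0. exactly_detectable_at M w F G H k0 N)"

definition ESMS ::
    "'a measure \<Rightarrow> (nat \<Rightarrow> 'a \<Rightarrow> real) \<Rightarrow> (nat \<Rightarrow> real ^ 'n ^ 'n) \<Rightarrow> (nat \<Rightarrow> real ^ 'n ^ 'n) \<Rightarrow> bool"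
  where
  "ESMS M w F G \<longleftrightarrow>
     (\<exists>\<beta> \<rho>::real. 1 \<le> \<beta> \<and> 0 < \<rho> \<and> \<rho> < 1 \<and>
        (\<forall>k0 k. k0 \<le> k \<longrightarrow> (\<forall>\<xi>\<in>l2_states M w k0.
          (\<integral>\<omega>. (norm (trajectory F G w k0 \<xi> (k - k0) \<omega>))\<^sup>2 \<partial>M)
            \<le> \<beta> * (\<integral>\<omega>. (norm (\<xi> \<omega>))\<^sup>2 \<partial>M) * \<rho> ^ (k - k0))))"

definition psd_matrix :: "real ^ 'n ^ 'n \<Rightarrow> bool" where
  "psd_matrix A \<longleftrightarrow> transpose A = A \<and> (\<forall>x. 0 \<le> x \<bullet> (A *v x))"

definition mat_ker :: "real ^ 'n ^ 'm \<Rightarrow> (real ^ 'n) set" where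
  "mat_ker A = {x. A *v x = 0}"

end

theory Submission
  imports Defs
begin

text \<open>
  Everything reduces to second moments, and those evolve deterministically. Since \<open>w k\<close> is
  centred, has variance 1 and is independent of the state at time \<open>k\<close>, the second moment form
  \<open>x \<bullet> A x\<close> one step ahead has the same expectation as the form of
  \<open>L k A = F\<^sup>T A F + G\<^sup>T A G\<close> now (\<open>one_step_moment\<close>). Composing these monotone linear
  operators backwards in time gives \<open>backward\<close>, and exponential stability in mean square becomes
  exponential decay of \<open>backward F G k j 1\<close> as a quadratic form.

  Unrolling the Lyapunov equation over \<open>j\<close> steps splits \<open>P k\<close> into a positive semi-definite
  remainder and the observability Gramian over the window \<open>{k..<k + j}\<close>
  (\<open>lyapunov_solution_unroll\<close>). Fix a window length \<open>m\<close> that is a multiple of the period, exceeds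
  \<open>N\<close>, and is so long that a state unobservable at time 0 loses more than half of its second moment
  within \<open>m\<close> steps. Let \<open>T\<close> be the backward operator over \<open>m\<close> steps and \<open>S\<close> the Gramian of the
  window. A deterministic vector in the kernel of \<open>S\<close> is unobservable, so \<open>T 1 < 1 / 2\<close> on that
  kernel; by compactness of the unit sphere (\<open>finsler\<close>) there is a constant \<open>c\<close> with
  \<open>T 1 \<le> 1 / 2 + c S\<close> everywhere. Thus a state loses energy up to a multiple of the output energy
  that it produces, and the total output energy along a trajectory is bounded by \<open>P 0\<close>. Hence the
  iterates of \<open>T\<close> at 1 have uniformly bounded partial sums, which for a semigroup of monotone
  operators forces some iterate to be at most \<open>1 / 2\<close> (\<open>sampled_decay\<close>). Periodicity turns this
  single contraction into a rate that is uniform in the initial time (\<open>uniform_decay\<close>).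
\<close>

section \<open>Quadratic forms\<close>

definition quad :: "real ^ 'n ^ 'n \<Rightarrow> real ^ 'n \<Rightarrow> real" where
  "quad A x = x \<bullet> (A *v x)"

lemma inner_transpose_mult: "x \<bullet> (y v* B) = (B *v x) \<bullet> y"
  for x :: "real ^ 'n" and y :: "real ^ 'm"
  by (metis dot_lmul_matrix inner_commute)

lemma quad_congruence: "quad (transpose B ** A ** B) x = quad A (B *v x)"
  by (simp add: quad_def inner_transpose_mult flip: matrix_vector_mul_assoc)

lemma quad_gram: "quad (transpose B ** B) x = (norm (B *v x))\<^sup>2"
  for B :: "real ^ 'n ^ 'm"
  by (simp add: quad_def inner_transpose_mult power2_norm_eq_inner flip: matrix_vector_mul_assoc)

lemma quad_one [simp]: "quad (mat 1) x = (norm x)\<^sup>2"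
  by (simp add: quad_def power2_norm_eq_inner)

lemma quad_add: "quad (A + B) x = quad A x + quad B x"
  by (simp add: quad_def matrix_vector_mult_add_rdistrib inner_add_right)

lemma quad_sum: "quad (sum A I) x = (\<Sum>i\<in>I. quad (A i) x)"
proof (induction I rule: infinite_finite_induct)
  case (insert i I)
  then show ?case by (simp add: quad_add)
qed (simp_all add: quad_def)

lemma quad_scaleR_vector: "quad A (c *\<^sub>R x) = c\<^sup>2 * quad A x"
  by (simp add: quad_def power2_eq_square matrix_vector_mult_scaleR)

lemma continuous_on_quad [continuous_intros]: "continuous_on S (quad A)"
  unfolding quad_def
  by (intro continuous_intros linear_continuous_on linear_conv_bounded_linear[THEN iffD1]
      matrix_vector_mul_linear)

lemma bilinear_form_bound:
  fixes A :: "real ^ 'n ^ 'm"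
  obtains C :: real where "\<And>x y. \<bar>x \<bullet> (A *v y)\<bar> \<le> C * norm x * norm y"
proof -
  obtain C where C: "\<And>y. norm (A *v y) \<le> norm y * C"
    using bounded_linear.bounded[OF matrix_vector_mul_bounded_linear[of A]] by blast
  have "\<bar>x \<bullet> (A *v y)\<bar> \<le> C * norm x * norm y" for x y
  proof -
    have "\<bar>x \<bullet> (A *v y)\<bar> \<le> norm x * norm (A *v y)"
      by (rule Cauchy_Schwarz_ineq2)
    also have "\<dots> \<le> norm x * (norm y * C)"
      by (intro mult_left_mono C) simp
    finally show ?thesis by (simp add: mult_ac)
  qed
  then show thesis by (rule that)
qed

lemma quad_bound:
  obtains C :: real where "\<And>x. quad A x \<le> C * (norm x)\<^sup>2"
proof -
  obtain C where "\<And>x y. \<bar>x \<bullet> (A *v y)\<bar> \<le> C * norm x * norm y"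
    by (rule bilinear_form_bound[of A]) blast
  then have "quad A x \<le> C * (norm x)\<^sup>2" for x
    by (metis abs_le_D1 mult.assoc power2_eq_square quad_def)
  then show thesis by (rule that)
qed

text \<open>
  Finsler's lemma. On the part of the unit sphere where \<open>quad Q\<close> is at least \<open>a\<close>, the form
  \<open>quad S\<close> is strictly positive, hence bounded away from 0 by compactness; a large multiple of it
  absorbs the bounded excess of \<open>quad Q\<close> over \<open>a\<close>.
\<close>

lemma finsler:
  fixes Q S :: "real ^ 'n ^ 'n" and a :: real
  assumes nonneg: "\<And>x. 0 \<le> quad S x"
    and kernel: "\<And>x. x \<noteq> 0 \<Longrightarrow> quad S x = 0 \<Longrightarrow> quad Q x < a * (norm x)\<^sup>2"
  obtains c where "0 \<le> c" "\<And>x. quad Q x \<le> a * (norm x)\<^sup>2 + c * quad S x"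
proof -
  \<comment> \<open>The unit vectors at which the inequality needs help from the term with \<open>S\<close>.\<close>
  define K where "K = {x \<in> sphere 0 1. a \<le> quad Q x}"
  have K: "compact K"
    unfolding K_def Collect_conj_eq Collect_mem_eq
    by (intro compact_Int_closed compact_sphere closed_Collect_le continuous_intros)
  have "\<exists>c\<ge>0. \<forall>x\<in>sphere 0 1. quad Q x \<le> a + c * quad S x"
  proof (cases "K = {}")
    case True
    then show ?thesis by (intro exI[of _ 0]) (auto simp: K_def)
  next
    case False
    obtain u where u: "u \<in> K" "\<And>x. x \<in> K \<Longrightarrow> quad S u \<le> quad S x"
      using continuous_attains_inf[OF K False continuous_on_quad] by blast
    obtain v where v: "v \<in> K" "\<And>x. x \<in> K \<Longrightarrow> quad Q x \<le> quad Q v"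
      using continuous_attains_sup[OF K False continuous_on_quad] by blast
    have pos: "0 < quad S u"
      using kernel[of u] nonneg[of u] u(1) by (force simp: K_def)
    define c where "c = (quad Q v - a) / quad S u"
    have c: "0 \<le> c" using v(1) pos by (auto simp: c_def K_def)
    have "quad Q x \<le> a + c * quad S x" if "x \<in> sphere 0 1" for x
    proof (cases "x \<in> K")
      case True
      have "quad Q x - a \<le> c * quad S u" using v(2)[OF True] pos by (simp add: c_def)
      also have "\<dots> \<le> c * quad S x" by (intro mult_left_mono u(2) True c)
      finally show ?thesis by simp
    next
      case False
      then have "quad Q x < a" using that by (simp add: K_def)
      then show ?thesis using mult_nonneg_nonneg[OF c nonneg[of x]] by linarith
    qed
    then show ?thesis using c by blast
  qed
  then obtain c where c: "0 \<le> c"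
    "\<And>x. norm x = 1 \<Longrightarrow> quad Q x \<le> a + c * quad S x"
    by auto
  have "quad Q x \<le> a * (norm x)\<^sup>2 + c * quad S x" for x
  proof (cases "x = 0")
    case True
    then show ?thesis by (simp add: quad_def)
  next
    case False
    define e where "e = (1 / norm x) *\<^sub>R x"
    have "norm e = 1" "x = norm x *\<^sub>R e" using False by (auto simp: e_def)
    then have "quad Q x = (norm x)\<^sup>2 * quad Q e" "quad S x = (norm x)\<^sup>2 * quad S e"
      by (metis quad_scaleR_vector)+
    moreover have "(norm x)\<^sup>2 * quad Q e \<le> (norm x)\<^sup>2 * (a + c * quad S e)"
      by (intro mult_left_mono c(2) \<open>norm e = 1\<close>) simp
    ultimately show ?thesis by (simp add: algebra_simps)
  qed
  with c(1) show thesis by (rule that)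
qed

section \<open>Backward evolution of quadratic forms\<close>

definition lyapunov_op ::
    "(nat \<Rightarrow> real ^ 'n ^ 'n) \<Rightarrow> (nat \<Rightarrow> real ^ 'n ^ 'n) \<Rightarrow> nat \<Rightarrow> real ^ 'n ^ 'n \<Rightarrow> real ^ 'n ^ 'n"
  where "lyapunov_op F G k A = transpose (F k) ** A ** F k + transpose (G k) ** A ** G k"

text \<open>
  \<open>backward F G k j A\<close> is the matrix of the quadratic form that maps an initial vector at time
  \<open>k\<close> to the expected value of \<open>quad A\<close> at time \<open>k + j\<close>. The recursion peels off the last step, as
  the recursion of \<open>trajectory\<close> does.
\<close>

primrec backward ::
    "(nat \<Rightarrow> real ^ 'n ^ 'n) \<Rightarrow> (nat \<Rightarrow> real ^ 'n ^ 'n) \<Rightarrow> nat \<Rightarrow> nat \<Rightarrow>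
     real ^ 'n ^ 'n \<Rightarrow> real ^ 'n ^ 'n" where
  "backward F G k 0 A = A"
| "backward F G k (Suc j) A = backward F G k j (lyapunov_op F G (k + j) A)"

lemma quad_lyapunov_op:
  "quad (lyapunov_op F G k A) x = quad A (F k *v x) + quad A (G k *v x)"
  by (simp add: lyapunov_op_def quad_add quad_congruence)

lemma matrix_add_rdistrib: "(A + B) ** C = A ** C + B ** C"
  by (vector matrix_matrix_mult_def sum.distrib[symmetric] field_simps)

lemma backward_add: "backward F G k j (A + B) = backward F G k j A + backward F G k j B"
proof (induction j arbitrary: A B)
  case (Suc j)
  have "lyapunov_op F G (k + j) (A + B) = lyapunov_op F G (k + j) A + lyapunov_op F G (k + j) B"
    by (simp add: lyapunov_op_def matrix_add_ldistrib matrix_add_rdistrib)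
  with Suc show ?case by simp
qed simp

lemma backward_plus: "backward F G k (i + j) A = backward F G k i (backward F G (k + i) j A)"
  by (induction j arbitrary: A) (simp_all add: add.assoc)

text \<open>
  Each Lyapunov operator replaces a form by the sum of its pullbacks along \<open>F k\<close> and \<open>G k\<close>, and
  pullbacks preserve linear inequalities between forms.
\<close>

lemma backward_le_combination:
  assumes "\<And>x. quad A x \<le> a * quad B x + c * quad C x"
  shows "quad (backward F G k j A) x \<le> a * quad (backward F G k j B) x
           + c * quad (backward F G k j C) x"
  using assms
proof (induction j arbitrary: A B C x)
  case (Suc j)
  have "quad (lyapunov_op F G (k + j) A) y \<le> a * quad (lyapunov_op F G (k + j) B) y
      + c * quad (lyapunov_op F G (k + j) C) y" for y
    using add_mono[OF Suc.prems[of "F (k + j) *v y"] Suc.prems[of "G (k + j) *v y"]]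
    by (simp add: quad_lyapunov_op algebra_simps)
  then show ?case by (simp add: Suc.IH)
qed simp

lemma backward_le_scaled:
  assumes "\<And>x. quad A x \<le> a * quad B x"
  shows "quad (backward F G k j A) x \<le> a * quad (backward F G k j B) x"
  using backward_le_combination[of A a B 0 B] assms by simp

lemma backward_nonneg:
  assumes "\<And>x. 0 \<le> quad A x"
  shows "0 \<le> quad (backward F G k j A) x"
  using assms by (induction j arbitrary: A) (simp_all add: quad_lyapunov_op)

lemma backward_periodic:
  assumes "\<And>k. F (k + \<tau>) = F k" "\<And>k. G (k + \<tau>) = G k"
  shows "backward F G (k + \<tau>) j A = backward F G k j A"
proof (induction j arbitrary: A)
  case (Suc j)
  have "lyapunov_op F G (k + \<tau> + j) A = lyapunov_op F G (k + j) A"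
    using assms[of "k + j"] by (simp add: lyapunov_op_def add_ac)
  with Suc show ?case by simp
qed simp

section \<open>The observability Gramian\<close>

definition obs_gramian ::
    "(nat \<Rightarrow> real ^ 'n ^ 'n) \<Rightarrow> (nat \<Rightarrow> real ^ 'n ^ 'n) \<Rightarrow> (nat \<Rightarrow> real ^ 'n ^ 'm) \<Rightarrow>
     nat \<Rightarrow> nat \<Rightarrow> real ^ 'n ^ 'n" where
  "obs_gramian F G H k j = (\<Sum>i<j. backward F G k i (transpose (H (k + i)) ** H (k + i)))"

lemma obs_gramian_nonneg: "0 \<le> quad (obs_gramian F G H k j) x"
  by (simp add: obs_gramian_def quad_sum sum_nonneg backward_nonneg quad_gram)

text \<open>
  This is the energy balance of the system: what \<open>P k\<close> assigns to a state is the expected output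
  energy on \<open>{k..<k + j}\<close> plus what is left at time \<open>k + j\<close>.
\<close>

lemma lyapunov_solution_unroll:
  assumes "\<And>k. P k = lyapunov_op F G k (P (Suc k)) + transpose (H k) ** H k"
  shows "P k = backward F G k j (P (k + j)) + obs_gramian F G H k j"
proof (induction j)
  case 0
  then show ?case by (simp add: obs_gramian_def)
next
  case (Suc j)
  have "backward F G k j (P (k + j)) = backward F G k (Suc j) (P (k + Suc j))
      + backward F G k j (transpose (H (k + j)) ** H (k + j))"
    by (subst assms) (simp add: backward_add)
  with Suc show ?case by (simp add: obs_gramian_def add_ac)
qed

lemma periodic_mult:
  fixes f :: "nat \<Rightarrow> 'b"
  assumes "\<And>k. f (k + \<tau>) = f k"
  shows "f (k + i * \<tau>) = f k"
proof (induction i)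
  case (Suc i)
  then show ?case using assms[of "k + i * \<tau>"] by (simp add: add_ac)
qed simp

section \<open>Decay of the backward evolution\<close>

text \<open>
  Over one period a state keeps at most half of its second moment, up to a multiple of the output
  energy that it produces. All the output energy together is bounded by \<open>P 0\<close>, since the Gramian is
  the same in every window, so that the energy balances of the windows telescope, and the remainder
  left after the last window is nonnegative. Hence the second moments at multiples of \<open>m\<close> have
  a sum bounded uniformly in the initial vector of norm 1.
\<close>

lemma sampled_decay:
  fixes F G P :: "nat \<Rightarrow> real ^ 'n ^ 'n" and H :: "nat \<Rightarrow> real ^ 'n ^ 'm"
  assumes period: "\<And>k. F (k + m) = F k" "\<And>k. G (k + m) = G k" "\<And>k. H (k + m) = H k"
    and lyapunov: "\<And>k. P k = lyapunov_op F G k (P (Suc k)) + transpose (H k) ** H k"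
    and psd: "\<And>k x. 0 \<le> quad (P k) x"
    and unobservable_decay: "\<And>x. x \<noteq> 0 \<Longrightarrow> quad (obs_gramian F G H 0 m) x = 0
        \<Longrightarrow> quad (backward F G 0 m (mat 1)) x < 1 / 2 * (norm x)\<^sup>2"
  obtains n where "0 < n"
    "\<And>x. quad (backward F G 0 (n * m) (mat 1)) x \<le> 1 / 2 * (norm x)\<^sup>2"
proof -
  define T where "T i A = backward F G 0 (i * m) A" for i A
  define S where "S = obs_gramian F G H 0 m"
  have shift: "backward F G (i * m) j A = backward F G 0 j A" for i j A
    using periodic_mult[where f = "\<lambda>k. backward F G k j A" and \<tau> = m and k = 0]
    by (simp add: backward_periodic[where F = F and G = G, OF period(1) period(2)])
  have T_add: "T (i + j) A = T i (T j A)" for i j A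
    by (simp add: T_def add_mult_distrib backward_plus shift)
  have gramian_shift: "obs_gramian F G H (i * m) m = S" for i
    unfolding S_def obs_gramian_def
    using periodic_mult[where f = H and \<tau> = m, OF period(3)]
    by (simp add: shift add.commute[of "i * m"])
  \<comment> \<open>The output energy of the first \<open>n\<close> windows is what \<open>P\<close> has lost over them.\<close>
  have telescope: "(\<Sum>i<n. quad (T i S) x) = quad (P 0) x - quad (T n (P (n * m))) x" for n x
  proof (induction n)
    case 0
    then show ?case by (simp add: T_def)
  next
    case (Suc n)
    have "P (n * m) = T 1 (P (Suc n * m)) + S"
      using lyapunov_solution_unroll[where P = P, OF lyapunov, of "n * m" m]
      by (simp add: T_def shift gramian_shift add_ac)
    then have "T n (P (n * m)) = T n (T 1 (P (Suc n * m))) + T n S"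
      by (simp add: T_def backward_add)
    also have "T n (T 1 (P (Suc n * m))) = T (Suc n) (P (Suc n * m))"
      using T_add[of n 1] by simp
    finally show ?case using Suc by (simp add: quad_add)
  qed
  obtain c where c: "0 \<le> c"
    "\<And>x. quad (T 1 (mat 1)) x \<le> 1 / 2 * (norm x)\<^sup>2 + c * quad S x"
    using finsler[of S "T 1 (mat 1)" "1 / 2"] unobservable_decay
    by (auto simp: S_def T_def obs_gramian_nonneg)
  obtain B where B: "\<And>x. quad (P 0) x \<le> B * (norm x)\<^sup>2"
    by (rule quad_bound[of "P 0"]) blast
  define K where "K = max 1 (2 + 2 * c * B)"
  have nonneg: "0 \<le> quad (T i (mat 1)) x" for i x
    by (simp add: T_def backward_nonneg)
  have summable: "(\<Sum>i<n. quad (T i (mat 1)) x) \<le> K * (norm x)\<^sup>2" for n x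
  proof -
    have step: "quad (T (Suc i) (mat 1)) x \<le> 1 / 2 * quad (T i (mat 1)) x + c * quad (T i S) x" for i
    proof -
      have "T (Suc i) (mat 1) = T i (T 1 (mat 1))" using T_add[of i 1] by simp
      moreover have "quad (T i (T 1 (mat 1))) x \<le> 1 / 2 * quad (T i (mat 1)) x + c * quad (T i S) x"
        unfolding T_def[of i] by (rule backward_le_combination) (use c(2) in simp)
      ultimately show ?thesis by simp
    qed
    \<comment> \<open>Going from \<open>n\<close> to \<open>n + 1\<close>, the second term on the left drops by at least the new summand of
      the first one, up to output energy.\<close>
    have "(\<Sum>i<n. quad (T i (mat 1)) x) + 2 * quad (T n (mat 1)) x
        \<le> 2 * (norm x)\<^sup>2 + 2 * c * (\<Sum>i<n. quad (T i S) x)"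
    proof (induction n)
      case 0
      then show ?case by (simp add: T_def)
    next
      case (Suc n)
      then show ?case using step[of n] by (simp add: algebra_simps)
    qed
    moreover have "(\<Sum>i<n. quad (T i S) x) \<le> B * (norm x)\<^sup>2"
    proof -
      have "0 \<le> quad (T n (P (n * m))) x" unfolding T_def by (intro backward_nonneg psd)
      then show ?thesis using B[of x] unfolding telescope by linarith
    qed
    then have "2 * c * (\<Sum>i<n. quad (T i S) x) \<le> 2 * c * (B * (norm x)\<^sup>2)"
      using c(1) by (intro mult_left_mono) auto
    moreover have "(2 + 2 * c * B) * (norm x)\<^sup>2 \<le> K * (norm x)\<^sup>2"
      by (intro mult_right_mono) (auto simp: K_def)
    ultimately show ?thesis using nonneg[of n x] by (simp add: algebra_simps)
  qed
  have bounded: "quad (T i (mat 1)) x \<le> K * (norm x)\<^sup>2" for i x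
  proof -
    have "0 \<le> (\<Sum>j<i. quad (T j (mat 1)) x)" by (intro sum_nonneg nonneg)
    then show ?thesis using summable[of x "Suc i"] by simp
  qed
  \<comment> \<open>The iterates are bounded by \<open>K\<close>, so \<open>T n 1 = T i (T (n - i) 1) \<le> K * T i 1\<close> for each
    \<open>i < n\<close>. Adding up these \<open>n\<close> bounds shows that the iterates decay at least like \<open>1 / n\<close>.\<close>
  have averaged: "real n * quad (T n (mat 1)) x \<le> K * (K * (norm x)\<^sup>2)" for n x
  proof -
    have "quad (T n (mat 1)) x \<le> K * quad (T i (mat 1)) x" if "i < n" for i
    proof -
      have "quad (T i (T (n - i) (mat 1))) x \<le> K * quad (T i (mat 1)) x"
        unfolding T_def[of i] by (rule backward_le_scaled) (use bounded in simp)
      then show ?thesis using that by (simp flip: T_add)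
    qed
    then have "(\<Sum>i<n. quad (T n (mat 1)) x) \<le> (\<Sum>i<n. K * quad (T i (mat 1)) x)"
      by (intro sum_mono) auto
    also have "\<dots> \<le> K * (K * (norm x)\<^sup>2)"
      using summable by (auto simp: K_def simp flip: sum_distrib_left intro!: mult_left_mono)
    finally show ?thesis by simp
  qed
  obtain n where n: "2 * (K * K) < real n"
    using reals_Archimedean2 by blast
  have KK: "1 \<le> K * K" using mult_mono[of 1 K 1 K] by (simp add: K_def)
  then have pos: "0 < real n" using n by linarith
  have "quad (T n (mat 1)) x \<le> 1 / 2 * (norm x)\<^sup>2" for x
  proof -
    have "real n * quad (T n (mat 1)) x \<le> K * K * (norm x)\<^sup>2"
      using averaged[of n x] by (simp add: mult.assoc)
    also have "\<dots> \<le> (real n / 2) * (norm x)\<^sup>2"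
      using n by (intro mult_right_mono) auto
    finally have "real n * quad (T n (mat 1)) x \<le> real n * (1 / 2 * (norm x)\<^sup>2)" by simp
    then show ?thesis using pos by (simp only: mult_le_cancel_left_pos)
  qed
  then show thesis using pos that[of n] by (simp add: T_def)
qed

text \<open>
  Over a time interval of length \<open>j\<close> at least \<open>j - 2 p\<close> steps lie in full periods, and each full
  period halves the second moment. The at most \<open>2 p\<close> remaining steps at the two ends contribute
  no more than a fixed factor.
\<close>

lemma uniform_decay:
  fixes F G :: "nat \<Rightarrow> real ^ 'n ^ 'n"
  assumes p: "0 < p" and period: "\<And>k. F (k + p) = F k" "\<And>k. G (k + p) = G k"
    and half: "\<And>x. quad (backward F G 0 p (mat 1)) x \<le> 1 / 2 * (norm x)\<^sup>2"
  obtains \<beta> \<rho> :: real where "1 \<le> \<beta>" "0 < \<rho>" "\<rho> < 1"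
    "\<And>k j x. quad (backward F G k j (mat 1)) x \<le> \<beta> * \<rho> ^ j * (norm x)\<^sup>2"
proof -
  have shift: "backward F G (i * p) j A = backward F G 0 j A" for i j A
    using periodic_mult[where f = "\<lambda>k. backward F G k j A" and \<tau> = p and k = 0]
    by (simp add: backward_periodic[where F = F and G = G, OF period(1) period(2)])
  have "\<exists>C. \<forall>x. quad (lyapunov_op F G k (mat 1)) x \<le> C * (norm x)\<^sup>2" for k
    by (rule quad_bound[of "lyapunov_op F G k (mat 1)"]) blast
  then obtain C where C: "\<And>k x. quad (lyapunov_op F G k (mat 1)) x \<le> C k * (norm x)\<^sup>2"
    by metis
  define \<kappa> where "\<kappa> = Max (insert 1 (C ` {..<p}))"
  have \<kappa>: "1 \<le> \<kappa>" "\<And>k. k < p \<Longrightarrow> C k \<le> \<kappa>" by (simp_all add: \<kappa>_def)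
  have one_step: "quad (lyapunov_op F G k (mat 1)) x \<le> \<kappa> * (norm x)\<^sup>2" for k x
  proof -
    have "F k = F (k mod p)" "G k = G (k mod p)"
      using periodic_mult[where f = F and \<tau> = p, OF period(1), of "k mod p" "k div p"]
        periodic_mult[where f = G and \<tau> = p, OF period(2), of "k mod p" "k div p"] by simp_all
    then have "quad (lyapunov_op F G k (mat 1)) x = quad (lyapunov_op F G (k mod p) (mat 1)) x"
      by (simp add: quad_lyapunov_op)
    also have "\<dots> \<le> C (k mod p) * (norm x)\<^sup>2" by (rule C)
    also have "\<dots> \<le> \<kappa> * (norm x)\<^sup>2" using p by (intro mult_right_mono \<kappa>) auto
    finally show ?thesis .
  qed
  have growth: "quad (backward F G k j (mat 1)) x \<le> \<kappa> ^ j * (norm x)\<^sup>2" for k j x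
  proof (induction j)
    case (Suc j)
    have "quad (backward F G k (Suc j) (mat 1)) x \<le> \<kappa> * quad (backward F G k j (mat 1)) x"
      using backward_le_scaled[of "lyapunov_op F G (k + j) (mat 1)" \<kappa> "mat 1"] one_step by simp
    also have "\<dots> \<le> \<kappa> * (\<kappa> ^ j * (norm x)\<^sup>2)"
      using Suc \<kappa>(1) by (intro mult_left_mono) auto
    finally show ?case by (simp add: mult.assoc)
  qed simp
  have sampled: "quad (backward F G 0 (i * p) (mat 1)) x \<le> (1 / 2) ^ i * (norm x)\<^sup>2" for i x
  proof (induction i)
    case (Suc i)
    have "quad (backward F G 0 (i * p + p) (mat 1)) x
        \<le> 1 / 2 * quad (backward F G 0 (i * p) (mat 1)) x"
      unfolding backward_plus using half
      by (intro backward_le_scaled) (simp add: shift)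
    with Suc show ?case by (simp add: add.commute)
  qed simp
  define \<rho> where "\<rho> = root p (1 / 2)"
  have \<rho>: "0 < \<rho>" "\<rho> < 1" "\<rho> ^ p = 1 / 2"
    using p by (simp_all add: \<rho>_def)
  \<comment> \<open>The factor 4 makes up for \<open>\<rho> ^ (2 * p) = 1 / 4\<close> at the ends of the interval.\<close>
  define \<beta> where "\<beta> = 4 * \<kappa> ^ (2 * p)"
  have \<beta>: "1 \<le> \<beta>" using one_le_power[OF \<kappa>(1), of "2 * p"] by (simp add: \<beta>_def)
  have short: "\<kappa> ^ a \<le> \<beta> * \<rho> ^ a" if "a \<le> 2 * p" for a
  proof -
    have "1 / 4 = \<rho> ^ (2 * p)" unfolding mult.commute[of 2] power_mult \<rho>(3) by (simp add: power2_eq_square)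
    also have "\<dots> \<le> \<rho> ^ a" using \<rho> that by (intro power_decreasing) auto
    finally have "\<kappa> ^ (2 * p) * 1 \<le> \<kappa> ^ (2 * p) * (4 * \<rho> ^ a)"
      using \<kappa>(1) by (intro mult_left_mono) auto
    moreover have "\<kappa> ^ a \<le> \<kappa> ^ (2 * p)" using \<kappa>(1) that by (intro power_increasing) auto
    ultimately show ?thesis by (simp add: \<beta>_def algebra_simps)
  qed
  have "quad (backward F G k j (mat 1)) x \<le> \<beta> * \<rho> ^ j * (norm x)\<^sup>2" for k j x
  proof -
    \<comment> \<open>After \<open>a\<close> steps the system reaches a multiple of \<open>p\<close>.\<close>
    define a where "a = p - k mod p"
    have a: "a \<le> p" "k + a = Suc (k div p) * p"
    proof -
      have "k mod p < p" using p by simp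
      moreover have "k div p * p + k mod p = k" by simp
      ultimately show "a \<le> p" "k + a = Suc (k div p) * p"
        unfolding a_def mult_Suc by linarith+
    qed
    show ?thesis
    proof (cases "j \<le> a")
      case True
      have "\<kappa> ^ j * (norm x)\<^sup>2 \<le> \<beta> * \<rho> ^ j * (norm x)\<^sup>2"
        using short[of j] True a(1) by (intro mult_right_mono) auto
      then show ?thesis using growth[of k j x] by simp
    next
      case False
      define i b where "i = (j - a) div p" and "b = (j - a) mod p"
      have j: "j = a + (i * p + b)" using False by (simp add: i_def b_def)
      have b: "b \<le> p" using p by (simp add: b_def less_imp_le)
      have "quad (backward F G 0 (i * p + b) (mat 1)) y \<le> \<kappa> ^ b * ((1 / 2) ^ i * (norm y)\<^sup>2)" for y
      proof -
        have "quad (backward F G 0 (i * p + b) (mat 1)) y \<le> \<kappa> ^ b * quad (backward F G 0 (i * p) (mat 1)) y"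
          unfolding backward_plus using growth by (intro backward_le_scaled) simp
        also have "\<dots> \<le> \<kappa> ^ b * ((1 / 2) ^ i * (norm y)\<^sup>2)"
          using \<kappa>(1) by (intro mult_left_mono sampled) auto
        finally show ?thesis .
      qed
      then have "quad (backward F G k j (mat 1)) x \<le> \<kappa> ^ b * (1 / 2) ^ i * quad (backward F G k a (mat 1)) x"
        unfolding j backward_plus[of F G k a] a(2) shift
        by (intro backward_le_scaled) (simp add: mult.assoc)
      also have "\<dots> \<le> \<kappa> ^ b * (1 / 2) ^ i * (\<kappa> ^ a * (norm x)\<^sup>2)"
        using \<kappa>(1) by (intro mult_left_mono growth) auto
      also have "\<dots> = (1 / 2) ^ i * \<kappa> ^ (a + b) * (norm x)\<^sup>2" by (simp add: power_add)
      also have "\<dots> \<le> (1 / 2) ^ i * (\<beta> * \<rho> ^ (a + b)) * (norm x)\<^sup>2"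
        using a(1) b by (intro mult_right_mono mult_left_mono short) auto
      also have "\<dots> = \<beta> * \<rho> ^ j * (norm x)\<^sup>2"
      proof -
        have "\<rho> ^ (i * p) = (1 / 2) ^ i" by (simp only: mult.commute[of i] power_mult \<rho>(3))
        then show ?thesis by (simp add: j power_add)
      qed
      finally show ?thesis .
    qed
  qed
  with \<beta> \<rho>(1,2) show thesis by (rule that)
qed

section \<open>Second moments of trajectories\<close>

lemma sets_noise_past:
  "sets (noise_past M w k)
     = sigma_sets (space M) {w i -` A \<inter> space M | i A. i < k \<and> A \<in> sets borel}"
  unfolding noise_past_def by (rule sets_measure_of) auto

lemma noise_past_mono:
  assumes "i \<le> j"
  shows "sets (noise_past M w i) \<subseteq> sets (noise_past M w j)"
  unfolding sets_noise_past
proof (rule sigma_sets_mono')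
  show "{w l -` A \<inter> space M | l A. l < i \<and> A \<in> sets borel}
      \<subseteq> {w l -` A \<inter> space M | l A. l < j \<and> A \<in> sets borel}"
    using less_le_trans[OF _ assms] by blast
qed

lemma space_noise_past [simp]: "space (noise_past M w k) = space M"
  by (simp add: noise_past_def space_measure_of_conv)

lemma noise_past_subset:
  assumes "\<And>i. w i \<in> borel_measurable M"
  shows "sets (noise_past M w k) \<subseteq> sets M"
  unfolding sets_noise_past
  by (rule sets.sigma_sets_subset) (auto intro!: measurable_sets[OF assms])

lemma measurable_noise_past_mono:
  assumes "f \<in> borel_measurable (noise_past M w i)" "i \<le> j"
  shows "f \<in> borel_measurable (noise_past M w j)"
  using assms noise_past_mono[OF assms(2), of M w] by (auto simp: measurable_def)

lemma noise_measurable_past: "w k \<in> borel_measurable (noise_past M w (Suc k))"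
proof (rule measurableI)
  fix A :: "real set" assume "A \<in> sets borel"
  then show "w k -` A \<inter> space (noise_past M w (Suc k)) \<in> sets (noise_past M w (Suc k))"
    unfolding space_noise_past sets_noise_past by (intro sigma_sets.Basic) blast
qed simp

text \<open>
  The noise variables are split into the blocks \<open>{k}\<close> and \<open>{..<k}\<close>; the sigma-algebras that
  disjoint blocks generate are independent, and the second of them is \<open>noise_past M w k\<close>.
\<close>

lemma noise_indep_past:
  assumes noise: "independent_white_noise M w"
    and f: "f \<in> borel_measurable borel"
    and Y: "Y \<in> borel_measurable (noise_past M w k)"
  shows "prob_space.indep_var M borel (\<lambda>\<omega>. f (w k \<omega>)) borel (Y :: 'a \<Rightarrow> real)"
proof -
  interpret prob_space M using noise by (simp add: independent_white_noise_def)
  have vars: "indep_vars (\<lambda>_. borel) w UNIV"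
    using noise by (simp add: independent_white_noise_def)
  then have w: "\<And>i. w i \<in> borel_measurable M" by (simp add: indep_vars_def)
  let ?E = "\<lambda>i. {w i -` A \<inter> space M | A. A \<in> sets borel}"
  let ?I = "case_bool {k} {..<k}"
  have "indep_sets (\<lambda>b. sigma_sets (space M) (\<Union>i\<in>?I b. ?E i)) UNIV"
  proof (rule indep_sets_collect_sigma)
    show "indep_sets ?E (\<Union>b\<in>UNIV. ?I b)"
      using vars unfolding indep_vars_def2 by (rule indep_sets_mono_index[rotated, OF conjunct2]) simp
    show "Int_stable (?E i)" for i
    proof (rule Int_stableI)
      fix a b assume "a \<in> ?E i" "b \<in> ?E i"
      then obtain A B where "a = w i -` A \<inter> space M" "b = w i -` B \<inter> space M"
        "A \<in> sets borel" "B \<in> sets borel" by blast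
      then have "a \<inter> b = w i -` (A \<inter> B) \<inter> space M" "A \<inter> B \<in> sets borel" by auto
      then show "a \<inter> b \<in> ?E i" by blast
    qed
    show "disjoint_family ?I"
      by (auto simp: disjoint_family_on_def split: bool.split)
  qed
  moreover have "(\<lambda>b. sigma_sets (space M) (\<Union>i\<in>?I b. ?E i))
      = case_bool (sigma_sets (space M) (?E k)) (sigma_sets (space M) (\<Union>i<k. ?E i))"
    by (rule ext) (simp split: bool.split)
  ultimately have indep: "indep_set (sigma_sets (space M) (?E k)) (sigma_sets (space M) (\<Union>i<k. ?E i))"
    unfolding indep_set_def by simp
  have "(\<Union>i<k. ?E i) = {w i -` A \<inter> space M | i A. i < k \<and> A \<in> sets borel}" by auto
  then have past: "sigma_sets (space M) (\<Union>i<k. ?E i) = sets (noise_past M w k)"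
    by (simp add: sets_noise_past)
  have Y_M: "Y \<in> borel_measurable M"
    using Y noise_past_subset[of w M k, OF w] by (auto simp: measurable_def)
  show ?thesis
    unfolding indep_var_eq
  proof (intro conjI)
    show "(\<lambda>\<omega>. f (w k \<omega>)) \<in> borel_measurable M"
      using measurable_compose[OF w f] .
    show "Y \<in> borel_measurable M" by (rule Y_M)
    have "{(\<lambda>\<omega>. f (w k \<omega>)) -` A \<inter> space M |A. A \<in> sets borel} \<subseteq> ?E k"
    proof safe
      fix A :: "real set" assume "A \<in> sets borel"
      then have "f -` A \<in> sets borel" using measurable_sets[OF f] by simp
      moreover have "(\<lambda>\<omega>. f (w k \<omega>)) -` A \<inter> space M = w k -` (f -` A) \<inter> space M" by auto
      ultimately show "\<exists>B. (\<lambda>\<omega>. f (w k \<omega>)) -` A \<inter> space M = w k -` B \<inter> space M \<and> B \<in> sets borel"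
        by blast
    qed
    then have 1: "sigma_sets (space M) {(\<lambda>\<omega>. f (w k \<omega>)) -` A \<inter> space M |A. A \<in> sets borel}
        \<subseteq> sigma_sets (space M) (?E k)" by (rule sigma_sets_mono')
    have "{Y -` A \<inter> space M |A. A \<in> sets borel} \<subseteq> sets (noise_past M w k)"
      using measurable_sets[OF Y] by auto
    then have 2: "sigma_sets (space M) {Y -` A \<inter> space M |A. A \<in> sets borel}
        \<subseteq> sigma_sets (space M) (\<Union>i<k. ?E i)"
      unfolding past using sets.sigma_sets_subset[of _ "noise_past M w k"] by simp
    show "indep_set (sigma_sets (space M) {(\<lambda>\<omega>. f (w k \<omega>)) -` A \<inter> space M |A. A \<in> sets borel})
        (sigma_sets (space M) {Y -` A \<inter> space M |A. A \<in> sets borel})"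
      using indep 1 2 unfolding indep_sets2_eq by blast
  qed
qed

lemma l2_statesD:
  assumes noise: "independent_white_noise M w" and X: "X \<in> l2_states M w k"
  shows "(\<lambda>\<omega>. X \<omega> \<bullet> (A *v X \<omega>)) \<in> borel_measurable (noise_past M w k)"
    and "integrable M (\<lambda>\<omega>. X \<omega> \<bullet> (A *v X \<omega>))"
proof -
  interpret prob_space M using noise by (simp add: independent_white_noise_def)
  have w: "\<And>i. w i \<in> borel_measurable M"
    using noise by (simp add: independent_white_noise_def indep_vars_def)
  have XP: "X \<in> borel_measurable (noise_past M w k)" and int: "integrable M (\<lambda>\<omega>. (norm (X \<omega>))\<^sup>2)"
    using X by (simp_all add: l2_states_def)
  have "quad A \<in> borel_measurable borel"
    by (intro borel_measurable_continuous_onI continuous_on_quad)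
  from measurable_compose[OF XP this]
  show past: "(\<lambda>\<omega>. X \<omega> \<bullet> (A *v X \<omega>)) \<in> borel_measurable (noise_past M w k)"
    by (simp add: quad_def)
  obtain C where C: "\<And>x y. \<bar>x \<bullet> (A *v y)\<bar> \<le> C * norm x * norm y"
    by (rule bilinear_form_bound[of A]) blast
  show "integrable M (\<lambda>\<omega>. X \<omega> \<bullet> (A *v X \<omega>))"
  proof (rule Bochner_Integration.integrable_bound)
    show "integrable M (\<lambda>\<omega>. C * (norm (X \<omega>))\<^sup>2)" using int by simp
    show "(\<lambda>\<omega>. X \<omega> \<bullet> (A *v X \<omega>)) \<in> borel_measurable M"
      using past noise_past_subset[of w M k, OF w] by (auto simp: measurable_def)
    show "AE \<omega> in M. norm (X \<omega> \<bullet> (A *v X \<omega>)) \<le> norm (C * (norm (X \<omega>))\<^sup>2)"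
      using C by (intro AE_I2) (smt (verit) mult.assoc power2_eq_square real_norm_def)
  qed
qed

lemma quad_noise_step:
  "quad A (B *v x + c *\<^sub>R (D *v x))
     = x \<bullet> ((transpose B ** A ** B) *v x)
       + c * (x \<bullet> ((transpose B ** A ** D + transpose D ** A ** B) *v x))
       + c\<^sup>2 * (x \<bullet> ((transpose D ** A ** D) *v x))"
proof -
  have congruence: "x \<bullet> ((transpose U ** A ** V) *v x) = (U *v x) \<bullet> (A *v (V *v x))" for U V
    by (simp add: inner_transpose_mult flip: matrix_vector_mul_assoc)
  show ?thesis
    unfolding quad_def matrix_vector_mult_add_rdistrib inner_add_right congruence
    by (simp add: matrix_vector_right_distrib matrix_vector_mult_scaleR inner_add_left
        inner_add_right power2_eq_square distrib_left)
qed

text \<open>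
  In the expansion of the form at the next state, the cross term carries the factor \<open>w k\<close> and the
  term quadratic in \<open>G k\<close> the factor \<open>(w k)\<^sup>2\<close>. Both are independent of the present state, so they may be
  replaced by their means 0 and 1.
\<close>

lemma one_step_moment:
  fixes F G :: "nat \<Rightarrow> real ^ 'n ^ 'n"
  assumes noise: "independent_white_noise M w" and X: "X \<in> l2_states M w k"
  defines "X' \<equiv> \<lambda>\<omega>. F k *v X \<omega> + w k \<omega> *\<^sub>R (G k *v X \<omega>)"
  shows "X' \<in> l2_states M w (Suc k)"
    and "(\<integral>\<omega>. quad A (X' \<omega>) \<partial>M) = (\<integral>\<omega>. quad (lyapunov_op F G k A) (X \<omega>) \<partial>M)"
proof -
  interpret prob_space M using noise by (simp add: independent_white_noise_def)
  have w: "\<And>i. w i \<in> borel_measurable M" "integrable M (\<lambda>\<omega>. (w k \<omega>)\<^sup>2)"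
    "(\<integral>\<omega>. w k \<omega> \<partial>M) = 0" "(\<integral>\<omega>. (w k \<omega>)\<^sup>2 \<partial>M) = 1"
    using noise by (simp_all add: independent_white_noise_def indep_vars_def power2_eq_square)
  have w1: "integrable M (w k)"
    using square_integrable_imp_integrable[OF w(1,2)] .
  note form = l2_statesD[OF noise X]
  have w_indep: "indep_var borel (\<lambda>\<omega>. w k \<omega>) borel (\<lambda>\<omega>. X \<omega> \<bullet> (B *v X \<omega>))"
    and w2_indep: "indep_var borel (\<lambda>\<omega>. (w k \<omega>)\<^sup>2) borel (\<lambda>\<omega>. X \<omega> \<bullet> (B *v X \<omega>))" for B
    by (rule noise_indep_past[OF noise _ form(1)], measurable)+
  have linear_term: "integrable M (\<lambda>\<omega>. w k \<omega> * (X \<omega> \<bullet> (B *v X \<omega>)))"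
    "(\<integral>\<omega>. w k \<omega> * (X \<omega> \<bullet> (B *v X \<omega>)) \<partial>M) = 0" for B
    using indep_var_integrable[OF w_indep w1 form(2)]
      indep_var_lebesgue_integral[OF w_indep w1 form(2), unfolded w(3) mult_zero_left] .
  have square_term: "integrable M (\<lambda>\<omega>. (w k \<omega>)\<^sup>2 * (X \<omega> \<bullet> (B *v X \<omega>)))"
    "(\<integral>\<omega>. (w k \<omega>)\<^sup>2 * (X \<omega> \<bullet> (B *v X \<omega>)) \<partial>M) = (\<integral>\<omega>. X \<omega> \<bullet> (B *v X \<omega>) \<partial>M)" for B
    using indep_var_integrable[OF w2_indep w(2) form(2)]
      indep_var_lebesgue_integral[OF w2_indep w(2) form(2), unfolded w(4) mult_1_left] .
  have "integrable M (\<lambda>\<omega>. quad B (X' \<omega>))" for B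
    unfolding X'_def quad_noise_step
    by (intro Bochner_Integration.integrable_add form(2) linear_term square_term)
  from this[of "mat 1"] have "integrable M (\<lambda>\<omega>. (norm (X' \<omega>))\<^sup>2)" by simp
  moreover have "X' \<in> borel_measurable (noise_past M w (Suc k))"
  proof -
    have past: "X \<in> borel_measurable (noise_past M w (Suc k))"
      by (rule measurable_noise_past_mono[of X M w k]) (use X in \<open>simp_all add: l2_states_def\<close>)
    have "(\<lambda>x. B *v x) \<in> borel_measurable borel" for B :: "real ^ 'n ^ 'n"
      by (intro borel_measurable_continuous_onI linear_continuous_on matrix_vector_mul_bounded_linear)
    note [measurable] = measurable_compose[OF past this] noise_measurable_past[of w k M]
    show ?thesis unfolding X'_def by measurable
  qed
  ultimately show "X' \<in> l2_states M w (Suc k)" by (simp add: l2_states_def)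
  have "(\<integral>\<omega>. quad A (X' \<omega>) \<partial>M)
      = (\<integral>\<omega>. X \<omega> \<bullet> ((transpose (F k) ** A ** F k) *v X \<omega>) \<partial>M)
        + (\<integral>\<omega>. X \<omega> \<bullet> ((transpose (G k) ** A ** G k) *v X \<omega>) \<partial>M)"
    unfolding X'_def quad_noise_step
    by (simp only: Bochner_Integration.integral_add Bochner_Integration.integrable_add form(2)
        linear_term square_term add_0_right)
  also have "\<dots> = (\<integral>\<omega>. quad (lyapunov_op F G k A) (X \<omega>) \<partial>M)"
    unfolding lyapunov_op_def quad_add unfolding quad_def
    by (rule Bochner_Integration.integral_add[symmetric]; rule form(2))
  finally show "(\<integral>\<omega>. quad A (X' \<omega>) \<partial>M) = (\<integral>\<omega>. quad (lyapunov_op F G k A) (X \<omega>) \<partial>M)" .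
qed

lemma trajectory_l2:
  assumes "independent_white_noise M w" "\<xi> \<in> l2_states M w k"
  shows "trajectory F G w k \<xi> j \<in> l2_states M w (k + j)"
proof (induction j)
  case (Suc j)
  then show ?case using one_step_moment(1)[OF assms(1) Suc, of F G] by simp
qed (use assms in simp)

lemma trajectory_moment:
  assumes "independent_white_noise M w" "\<xi> \<in> l2_states M w k"
  shows "(\<integral>\<omega>. quad A (trajectory F G w k \<xi> j \<omega>) \<partial>M)
           = (\<integral>\<omega>. quad (backward F G k j A) (\<xi> \<omega>) \<partial>M)"
proof (induction j arbitrary: A)
  case (Suc j)
  then show ?case
    using one_step_moment(2)[OF assms(1) trajectory_l2[OF assms, of F G j], where F = F and G = G and A = A] by simp
qed simp

lemma const_l2_state:
  assumes "prob_space M"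
  shows "(\<lambda>_. v) \<in> l2_states M w k"
proof -
  interpret prob_space M by fact
  show ?thesis by (simp add: l2_states_def)
qed

text \<open>
  The Gramian is the sum of the expected squared norms of the outputs, so each output on the
  window vanishes almost surely if the Gramian does.
\<close>

lemma unobservable_if_gramian_zero:
  assumes noise: "independent_white_noise M w" and N: "N < m"
    and zero: "quad (obs_gramian F G H k m) v = 0"
  shows "unobservable M w F G H k N (\<lambda>_. v)"
proof -
  interpret prob_space M using noise by (simp add: independent_white_noise_def)
  have v: "(\<lambda>_. v) \<in> l2_states M w k" by (rule const_l2_state) unfold_locales
  have "AE \<omega> in M. H (k + j) *v trajectory F G w k (\<lambda>_. v) j \<omega> = 0" if "j < m" for j
  proof -
    let ?A = "transpose (H (k + j)) ** H (k + j)"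
    have "quad (backward F G k j ?A) v = 0"
      using zero that unfolding obs_gramian_def quad_sum
      by (subst (asm) sum_nonneg_eq_0_iff) (auto simp: backward_nonneg quad_gram)
    then have "(\<integral>\<omega>. quad ?A (trajectory F G w k (\<lambda>_. v) j \<omega>) \<partial>M) = 0"
      by (simp add: trajectory_moment[OF noise v])
    then have "(\<integral>\<omega>. (norm (H (k + j) *v trajectory F G w k (\<lambda>_. v) j \<omega>))\<^sup>2 \<partial>M) = 0"
      by (simp add: quad_gram)
    moreover have "integrable M (\<lambda>\<omega>. (norm (H (k + j) *v trajectory F G w k (\<lambda>_. v) j \<omega>))\<^sup>2)"
      using l2_statesD(2)[OF noise trajectory_l2[OF noise v, of F G j], of ?A]
      by (simp flip: quad_def add: quad_gram)
    ultimately show ?thesis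
      by (simp add: integral_nonneg_eq_0_iff_AE)
  qed
  then show ?thesis
    unfolding unobservable_def using v N by (auto simp: le_iff_add)
qed

section \<open>Exponential stability in mean square\<close>

theorem theorem3p2p2:
  fixes M :: "'a measure"
    and w :: "nat \<Rightarrow> 'a \<Rightarrow> real"
    and F G P :: "nat \<Rightarrow> real ^ 'n ^ 'n"
    and H :: "nat \<Rightarrow> real ^ 'n ^ 'm"
    and \<tau> N :: nat
  assumes noise: "independent_white_noise M w"
    and period: "0 < \<tau>"
      "\<And>k. F (k + \<tau>) = F k" "\<And>k. G (k + \<tau>) = G k" "\<And>k. H (k + \<tau>) = H k"
    and detectable: "K_exactly_detectable M w F G H N"
    and psd: "\<And>k. psd_matrix (P k)"
    and lyapunov: "\<And>k. - P k + transpose (F k) ** P (k + 1) ** F k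
        + transpose (G k) ** P (k + 1) ** G k + transpose (H k) ** H k = 0"
    and kernels: "\<And>i j. i < \<tau> \<Longrightarrow> j < \<tau> \<Longrightarrow> mat_ker (P i) = mat_ker (P j)"
  shows "ESMS M w F G"
proof -
  interpret prob_space M using noise by (simp add: independent_white_noise_def)
  have moment: "(\<integral>\<omega>. (norm (trajectory F G w k \<xi> j \<omega>))\<^sup>2 \<partial>M)
      = (\<integral>\<omega>. quad (backward F G k j (mat 1)) (\<xi> \<omega>) \<partial>M)" if "\<xi> \<in> l2_states M w k" for k j \<xi>
    using trajectory_moment[OF noise that, of "mat 1"] by simp
  obtain \<beta> \<rho> :: real where \<rho>: "1 \<le> \<beta>" "0 < \<rho>" "\<rho> < 1"
    and decay: "\<And>\<xi> j. unobservable M w F G H 0 N \<xi> \<Longrightarrow>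
      (\<integral>\<omega>. (norm (trajectory F G w 0 \<xi> j \<omega>))\<^sup>2 \<partial>M) \<le> \<beta> * (\<integral>\<omega>. (norm (\<xi> \<omega>))\<^sup>2 \<partial>M) * \<rho> ^ j"
  proof -
    have "exactly_detectable_at M w F G H 0 N"
      using detectable by (simp add: K_exactly_detectable_def)
    then show thesis
      unfolding exactly_detectable_at_def using that by auto
  qed
  have "(\<lambda>i. \<beta> * \<rho> ^ i) \<longlonglongrightarrow> \<beta> * 0"
    using \<rho> by (intro tendsto_intros LIMSEQ_power_zero) auto
  then have "eventually (\<lambda>i. \<beta> * \<rho> ^ i < 1 / 2) sequentially"
    by (rule order_tendstoD) simp
  then obtain i0 where i0: "\<And>i. i0 \<le> i \<Longrightarrow> \<beta> * \<rho> ^ i < 1 / 2"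
    by (auto simp: eventually_sequentially)
  define m where "m = (i0 + Suc N) * \<tau>"
  have "i0 + Suc N \<le> m" using mult_le_mono2[of 1 \<tau> "i0 + Suc N"] period(1) by (simp add: m_def)
  then have m: "N < m" "\<beta> * \<rho> ^ m < 1 / 2" using i0[of m] by auto
  note sampled_period = periodic_mult[where \<tau> = \<tau> and i = "i0 + Suc N", folded m_def]
  have on_kernel: "quad (backward F G 0 m (mat 1)) x < 1 / 2 * (norm x)\<^sup>2"
    if "x \<noteq> 0" "quad (obs_gramian F G H 0 m) x = 0" for x
  proof -
    have "quad (backward F G 0 m (mat 1)) x \<le> \<beta> * (norm x)\<^sup>2 * \<rho> ^ m"
      using decay[OF unobservable_if_gramian_zero[OF noise m(1) that(2)], of m]
        moment[OF const_l2_state[OF prob_space_axioms, of x w 0], of m]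
      by (simp add: prob_space)
    also have "\<dots> = \<beta> * \<rho> ^ m * (norm x)\<^sup>2" by simp
    also have "\<dots> < 1 / 2 * (norm x)\<^sup>2"
      using m(2) that(1) by (intro mult_strict_right_mono) auto
    finally show ?thesis .
  qed
  have "P k = lyapunov_op F G k (P (Suc k)) + transpose (H k) ** H k" for k
    using lyapunov[of k] by (simp add: lyapunov_op_def algebra_simps)
  moreover have "0 \<le> quad (P k) x" for k x
    using psd[of k] by (simp add: psd_matrix_def quad_def)
  ultimately obtain n where n: "0 < n"
    "\<And>x. quad (backward F G 0 (n * m) (mat 1)) x \<le> 1 / 2 * (norm x)\<^sup>2"
    using sampled_decay[of F m G H P, OF sampled_period sampled_period sampled_period _ _ on_kernel]
      period(2-4) by blast
  have nm: "0 < n * m" using n(1) m(1) by simp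
  have F_nm: "F (k + n * m) = F k" and G_nm: "G (k + n * m) = G k" for k
    by (intro periodic_mult sampled_period period)+
  obtain b r :: real where br: "1 \<le> b" "0 < r" "r < 1"
    and uniform: "\<And>k j x. quad (backward F G k j (mat 1)) x \<le> b * r ^ j * (norm x)\<^sup>2"
    by (rule uniform_decay[OF nm F_nm G_nm n(2)]) blast
  have "(\<integral>\<omega>. (norm (trajectory F G w k0 \<xi> (k - k0) \<omega>))\<^sup>2 \<partial>M)
      \<le> b * (\<integral>\<omega>. (norm (\<xi> \<omega>))\<^sup>2 \<partial>M) * r ^ (k - k0)" if \<xi>: "\<xi> \<in> l2_states M w k0" for k0 k \<xi>
  proof -
    have "(\<integral>\<omega>. (norm (trajectory F G w k0 \<xi> (k - k0) \<omega>))\<^sup>2 \<partial>M)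
        \<le> (\<integral>\<omega>. b * r ^ (k - k0) * (norm (\<xi> \<omega>))\<^sup>2 \<partial>M)"
      unfolding moment[OF \<xi>] using \<xi> l2_statesD(2)[OF noise \<xi>]
      by (intro integral_mono uniform) (auto simp: quad_def l2_states_def)
    then show ?thesis by (simp add: mult_ac)
  qed
  with br show ?thesis unfolding ESMS_def by blast
qed

end
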